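(* Let $\Sigma$ be a finite alphabet, $(D,\leq,0,1)$ a linearly ordered set with smallest element $0$ and largest element $1$, $P=P[1..m]$ ($m\geq 1$) a fuzzy pattern over $\Sigma$, $\widehat{G}=\langle G,\Sigma,\xi\rangle$ a hierarchical structure over a finite ordered rooted tree $G$ with root $\Lambda$, and $\mu\in D$ a threshold. Then the FH-Matching algorithm, run on $P$, $\widehat{G}$, $\mu$, finds all and only the $\mu$-occurrences of $P$ in $\widehat{G}$; that is, for every node $g\in G$, the algorithm prints $g$ if and only if there is a descending chain $g_1,\ldots,g_m$ in $G$ with $g_m=g$ and $\xi(g_j)\sim_\mu P[j]$ for all $1\leq j\leq m$.
   Context: A fuzzy symbol over $\Sigma$ is a fuzzy subset $\alpha$ of $\Sigma$, i.e. it is given by a membership function $\mu_\alpha:\Sigma\to D$. A fuzzy pattern $P[1..m]$, $m\ge 1$, is a finite non-empty sequence of fuzzy symbols. For $c\in\Sigma$ and a fuzzy symbol $\alpha$, write $c\sim_\mu\alpha$ if $\mu_\alpha(c)\geq\mu$. For a string $x[1..q]$ over $\Sigma$ and a sequence $Q[1..q]$ of fuzzy symbols, write $x\sim_\mu Q$ if $x[j]\sim_\mu Q[j]$ for all $1\leq j\leq q$ (so the empty string $\varepsilon$ matches the empty sequence). $G$ is a finite ordered rooted tree (the tree of a finite partially ordered set with smallest element $\Lambda$); $succ(g)=\langle g_1,\ldots,g_h\rangle$, $h\geq 0$, is the ordered list of children of $g$. A descending chain of length $k\ge 1$ is a sequence $g_1,\ldots,g_k$ of nodes with $g_i\in succ(g_{i-1})$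 for $2\leq i\leq k$. A labeling is a map $\xi:G\to\Sigma$, and $\widehat{G}=\langle G,\Sigma,\xi\rangle$ is called a hierarchical structure over $G$. A $\mu$-occurrence of $P$ in $\widehat G$ is a descending chain $g_1,\ldots,g_m$ with $\xi(g_j)\sim_\mu P[j]$ for all $1\leq j\leq m$; it is identified by its end node $g_m$. The algorithm handles trajectories $\tau$: non-empty lists of strings over $\Sigma$ in order of decreasing length, whose last element is $\varepsilon$. The initial (empty) trajectory is $\tau_0=[\varepsilon]$. Let $head(\tau)$ be the first element of $\tau$, $tail(\tau)$ the list of the remaining elements, $length(\tau)$ the number of strings in $\tau$, and $width(\tau)=|head(\tau)|$. Operations, with $x=head(\tau)$ and $c\in\Sigma$: - $isPromoted(\tau,c)$ (used when $|x|<m$ and $x\sim_\mu P[1..|x|]$): true iff $c\sim_\mu P[|x|+1]$ (equivalently $xc\sim_\mu P[1..|x|+1]$). - $promote(\tau,c)$ (used when additionally $isPromoted(\tau,c)$ is true): the list, in order of decreasing length, of the strings in $\{x'c \mid x'\in\tau,\ c\sim_\mu P[|x'|+1]\}\cup\{\varepsilon\}$. - $rollback(\tau)$ (used when $|x|>0$): $tail(\tau)$. Procedure $visitNode(g,\tau)$, with $c=\xi(g)$: (1) while $length(\tau)>1$ and not $isPromoted(\tau,c)$, set $\tau:=rollback(\tau)$; (2) if $isPromoted(\tau,c)$, set $\tau:=promote(\tau,c)$; (3) if $width(\tau)=m$, print $g$ and set $\tau:=rollback(\tau)$; (4) return $\tau$. FH-Matching algorithm: start with a stack containing only the pair $\langle\Lambda,\tau_0\rangle$.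 While the stack is non-empty: pop the top pair $\langle g,\tau\rangle$; set $\tau:=visitNode(g,\tau)$; with $succ(g)=\langle g_1,\ldots,g_h\rangle$, push $\langle g_i,\tau\rangle$ for $i=h,h-1,\ldots,1$ in this order. *)

theory Defs
  imports Main "HOL-Library.While_Combinator"
begin

text \<open>The alphabet is a type \<open>'s\<close>, the linearly ordered set of membership grades a type
  \<open>'d\<close> (with \<open>0 = bot\<close> and \<open>1 = top\<close>).  Sequences are 0-based lists, so
  \<open>P[j]\<close> is \<open>P ! (j - 1)\<close>.\<close>

type_synonym ('s, 'd) fuzzy_symbol = "'s \<Rightarrow> 'd"
type_synonym ('s, 'd) fuzzy_pattern = "('s, 'd) fuzzy_symbol list"

definition fmatch :: "'d::linorder \<Rightarrow> 's \<Rightarrow> ('s, 'd) fuzzy_symbol \<Rightarrow> bool" where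
  "fmatch \<mu> c \<alpha> \<longleftrightarrow> \<alpha> c \<ge> \<mu>"

definition finite_ordered_tree :: "'g set \<Rightarrow> 'g \<Rightarrow> ('g \<Rightarrow> 'g list) \<Rightarrow> bool" where
  "finite_ordered_tree G \<Lambda> succ \<longleftrightarrow>
     finite G \<and> \<Lambda> \<in> G \<and>
     (\<forall>g\<in>G. distinct (succ g) \<and> set (succ g) \<subseteq> G) \<and>
     (\<forall>p\<in>G. \<Lambda> \<notin> set (succ p)) \<and>
     (\<forall>g\<in>G - {\<Lambda>}. \<exists>!p. p \<in> G \<and> g \<in> set (succ p)) \<and>
     (\<forall>g\<in>G. (\<Lambda>, g) \<in> {(a, b). a \<in> G \<and> b \<in> set (succ a)}\<^sup>*)"

definition descending_chain :: "'g set \<Rightarrow> ('g \<Rightarrow> 'g list) \<Rightarrow> 'g list \<Rightarrow> bool" where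
  "descending_chain G succ gs \<longleftrightarrow>
     gs \<noteq> [] \<and> set gs \<subseteq> G \<and>
     (\<forall>i. 1 \<le> i \<and> i < length gs \<longrightarrow> gs ! i \<in> set (succ (gs ! (i - 1))))"

definition mu_occurrence ::
  "'g set \<Rightarrow> ('g \<Rightarrow> 'g list) \<Rightarrow> ('g \<Rightarrow> 's) \<Rightarrow> ('s, 'd::linorder) fuzzy_pattern \<Rightarrow> 'd \<Rightarrow> 'g list \<Rightarrow> bool"
where
  "mu_occurrence G succ \<xi> P \<mu> gs \<longleftrightarrow>
     descending_chain G succ gs \<and> length gs = length P \<and>
     (\<forall>j < length P. fmatch \<mu> (\<xi> (gs ! j)) (P ! j))"

type_synonym 's trajectory = "'s list list"

definition width :: "'s trajectory \<Rightarrow> nat" where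
  "width \<tau> = length (hd \<tau>)"

text \<open>Only meaningful when \<open>width \<tau> < length P\<close>; this holds for every trajectory on the
  stack, since a trajectory of width \<open>length P\<close> is rolled back as soon as it arises.\<close>

definition isPromoted ::
  "('s, 'd::linorder) fuzzy_pattern \<Rightarrow> 'd \<Rightarrow> 's trajectory \<Rightarrow> 's \<Rightarrow> bool" where
  "isPromoted P \<mu> \<tau> c \<longleftrightarrow> fmatch \<mu> c (P ! width \<tau>)"

text \<open>The strings of a trajectory have pairwise different lengths, so listing the promoted
  strings by (strictly) decreasing length determines the list uniquely.\<close>

definition promote ::
  "('s, 'd::linorder) fuzzy_pattern \<Rightarrow> 'd \<Rightarrow> 's trajectory \<Rightarrow> 's \<Rightarrow> 's trajectory" where
  "promote P \<mu> \<tau> c =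
     (THE ys. set ys = {x @ [c] | x. x \<in> set \<tau> \<and> fmatch \<mu> c (P ! length x)} \<union> {[]} \<and>
              sorted_wrt (\<lambda>u v. length u > length v) ys)"

definition rollback :: "'s trajectory \<Rightarrow> 's trajectory" where
  "rollback \<tau> = tl \<tau>"

text \<open>The last component is the list of nodes printed so far.  The loop of step (1) always
  terminates, since each \<open>rollback\<close> shortens the trajectory; hence \<open>while\<close> is appropriate.\<close>

definition visitNode ::
  "('g \<Rightarrow> 's) \<Rightarrow> ('s, 'd::linorder) fuzzy_pattern \<Rightarrow> 'd \<Rightarrow> 'g \<Rightarrow> 's trajectory \<Rightarrow> 'g list
     \<Rightarrow> 's trajectory \<times> 'g list" where
  "visitNode \<xi> P \<mu> g \<tau> out =
     (let c = \<xi> g;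
          \<tau>1 = while (\<lambda>\<tau>. length \<tau> > 1 \<and> \<not> isPromoted P \<mu> \<tau> c) rollback \<tau>;
          \<tau>2 = (if isPromoted P \<mu> \<tau>1 c then promote P \<mu> \<tau>1 c else \<tau>1)
      in if width \<tau>2 = length P then (rollback \<tau>2, out @ [g]) else (\<tau>2, out))"

text \<open>The top of the stack is the head of the list; \<open>foldr\<close> pushes the last child first.\<close>

definition fh_step ::
  "('g \<Rightarrow> 'g list) \<Rightarrow> ('g \<Rightarrow> 's) \<Rightarrow> ('s, 'd::linorder) fuzzy_pattern \<Rightarrow> 'd
     \<Rightarrow> ('g \<times> 's trajectory) list \<times> 'g list \<Rightarrow> ('g \<times> 's trajectory) list \<times> 'g list" where
  "fh_step succ \<xi> P \<mu> = (\<lambda>(stack, out).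
     let (g, \<tau>) = hd stack;
         (\<tau>', out') = visitNode \<xi> P \<mu> g \<tau> out
     in (foldr (\<lambda>g' st. (g', \<tau>') # st) (succ g) (tl stack), out'))"

text \<open>The result is \<open>Some\<close> of the list of printed nodes if the algorithm terminates, and
  \<open>None\<close> otherwise.\<close>

definition fh_matching ::
  "'g \<Rightarrow> ('g \<Rightarrow> 'g list) \<Rightarrow> ('g \<Rightarrow> 's) \<Rightarrow> ('s, 'd::linorder) fuzzy_pattern \<Rightarrow> 'd \<Rightarrow> 'g list option"
where
  "fh_matching \<Lambda> succ \<xi> P \<mu> =
     map_option snd
       (while_option (\<lambda>(stack, out). stack \<noteq> []) (fh_step succ \<xi> P \<mu>) ([(\<Lambda>, [[]])], []))"

end

theory Submission
  imports Defs "HOL-Library.Sublist"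
begin

text \<open>Let \<open>w\<close> be the word of labels on the path from the root to the parent of \<open>g\<close>.  The
  trajectory on the stack together with \<open>g\<close> lists exactly the suffixes of \<open>w\<close> shorter
  than \<open>P\<close> that match a prefix of \<open>P\<close>: \<open>rollback\<close> only discards strings that the label of
  \<open>g\<close> fails to extend, so \<open>visitNode\<close> produces all matching suffixes of the extended word,
  and one of length \<open>length P\<close> is at the head if it exists.  Every chain ending in \<open>g\<close>
  extends upwards to the root, hence is seen as a suffix of a path from the root.\<close>

definition prefix_match :: "('s, 'd::linorder) fuzzy_pattern \<Rightarrow> 'd \<Rightarrow> 's list \<Rightarrow> bool" where
  "prefix_match P \<mu> x \<longleftrightarrow>
     length x \<le> length P \<and> (\<forall>j < length x. fmatch \<mu> (x ! j) (P ! j))"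

definition decreasing :: "'s trajectory \<Rightarrow> bool" where
  "decreasing \<tau> \<longleftrightarrow> sorted_wrt (\<lambda>u v. length u > length v) \<tau>"

text \<open>The bound is strict because a string of length \<open>length P\<close> is rolled back as
  soon as its end node is printed; thus \<open>P ! width \<tau>\<close> stays in range at the next
  node.\<close>

definition trajectory_of ::
  "('s, 'd::linorder) fuzzy_pattern \<Rightarrow> 'd \<Rightarrow> 's list \<Rightarrow> 's trajectory \<Rightarrow> bool" where
  "trajectory_of P \<mu> w \<tau> \<longleftrightarrow> decreasing \<tau> \<and>
     set \<tau> = {x. suffix x w \<and> length x < length P \<and> prefix_match P \<mu> x}"

definition suffix_occurrence :: "('s, 'd::linorder) fuzzy_pattern \<Rightarrow> 'd \<Rightarrow> 's list \<Rightarrow> bool" where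
  "suffix_occurrence P \<mu> w \<longleftrightarrow> (\<exists>x. suffix x w \<and> length x = length P \<and> prefix_match P \<mu> x)"

lemma prefix_match_Nil [simp]: "prefix_match P \<mu> []"
  by (simp add: prefix_match_def)

lemma prefix_match_snoc [simp]:
  "prefix_match P \<mu> (x @ [c]) \<longleftrightarrow>
     prefix_match P \<mu> x \<and> length x < length P \<and> fmatch \<mu> c (P ! length x)"
  by (auto simp: prefix_match_def nth_append less_Suc_eq)

section \<open>Trajectory operations and a single node visit\<close>

text \<open>The head is the unique longest string, so the two heads agree and can be removed from
  both sets. This gives the uniqueness that the \<open>THE\<close> in \<open>promote\<close> asks
  for.\<close>

lemma decreasing_set_eq:
  assumes "decreasing xs" "decreasing ys" "set xs = set ys"
  shows "xs = ys"
  using assms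
proof (induction xs arbitrary: ys)
  case Nil
  then show ?case by simp
next
  case (Cons x xs)
  then obtain y ys' where ys: "ys = y # ys'"
    by (cases ys) auto
  have "x = y"
    using Cons.prems unfolding ys decreasing_def
    by (metis list.set_intros(1) not_less_iff_gr_or_eq set_ConsD sorted_wrt.simps(2))
  moreover have "x \<notin> set xs" "y \<notin> set ys'"
    using Cons.prems unfolding ys decreasing_def by auto
  ultimately have "set xs = set ys'"
    using Cons.prems(3) ys by auto
  then show ?case
    using Cons \<open>x = y\<close> ys by (auto simp: decreasing_def)
qed

lemma promote_decreasing:
  assumes "decreasing \<tau>"
  shows "decreasing (promote P \<mu> \<tau> c)"
    and "set (promote P \<mu> \<tau> c) =
           {x @ [c] | x. x \<in> set \<tau> \<and> fmatch \<mu> c (P ! length x)} \<union> {[]}"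
proof -
  let ?Q = "\<lambda>ys. set ys = {x @ [c] | x. x \<in> set \<tau> \<and> fmatch \<mu> c (P ! length x)} \<union> {[]} \<and>
              sorted_wrt (\<lambda>u v. length u > length v) ys"
  \<comment> \<open>Appending one symbol to every string keeps the order of the lengths, and
    \<open>[]\<close> goes last because all other strings are now non-empty.\<close>
  let ?ys = "map (\<lambda>x. x @ [c]) (filter (\<lambda>x. fmatch \<mu> c (P ! length x)) \<tau>) @ [[]]"
  have "?Q ?ys"
    using assms by (auto simp: decreasing_def sorted_wrt_append sorted_wrt_map sorted_wrt_filter)
  moreover have "ys = ?ys" if "?Q ys" for ys
    using that \<open>?Q ?ys\<close> by (intro decreasing_set_eq) (simp_all add: decreasing_def)
  ultimately have "?Q (promote P \<mu> \<tau> c)"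
    unfolding promote_def by (rule theI)
  then show "decreasing (promote P \<mu> \<tau> c)"
    and "set (promote P \<mu> \<tau> c) =
           {x @ [c] | x. x \<in> set \<tau> \<and> fmatch \<mu> c (P ! length x)} \<union> {[]}"
    by (simp_all add: decreasing_def)
qed

text \<open>Only the head is tested, and it is dropped exactly when \<open>c\<close> does not extend
  it, so no promotable string is lost. The loop stops at a promotable head or when \<open>[]\<close>
  alone is left.\<close>

lemma rollback_loop:
  fixes P :: "('s, 'd::linorder) fuzzy_pattern" and \<mu> :: 'd and c :: 's
  assumes "decreasing \<tau>" "[] \<in> set \<tau>"
  defines "\<tau>' \<equiv> while (\<lambda>\<tau>. length \<tau> > 1 \<and> \<not> isPromoted P \<mu> \<tau> c) rollback \<tau>"
  shows "decreasing \<tau>'" "[] \<in> set \<tau>'" "set \<tau>' \<subseteq> set \<tau>"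
    and "\<And>x. \<lbrakk>x \<in> set \<tau>; fmatch \<mu> c (P ! length x)\<rbrakk> \<Longrightarrow> x \<in> set \<tau>'"
    and "\<tau>' = [[]] \<or> isPromoted P \<mu> \<tau>' c"
proof -
  define I where "I \<sigma> \<longleftrightarrow> decreasing \<sigma> \<and> [] \<in> set \<sigma> \<and> set \<sigma> \<subseteq> set \<tau> \<and>
    (\<forall>x\<in>set \<tau>. fmatch \<mu> c (P ! length x) \<longrightarrow> x \<in> set \<sigma>)" for \<sigma>
  let ?b = "\<lambda>\<tau>. length \<tau> > 1 \<and> \<not> isPromoted P \<mu> \<tau> c"
  have "I \<tau>' \<and> \<not> ?b \<tau>'"
    unfolding \<tau>'_def
  proof (rule while_rule[where r = "measure length" and P = I])
    show "I \<tau>"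
      using assms by (simp add: I_def)
    show "I (rollback \<sigma>)" if "I \<sigma>" "?b \<sigma>" for \<sigma>
    proof -
      from that obtain y z ys where \<sigma>: "\<sigma> = y # z # ys"
        by (cases \<sigma> rule: remdups_adj.cases) auto
      \<comment> \<open>Since the shorter string \<open>z\<close> follows, \<open>y\<close> is not
        empty, so dropping it keeps \<open>[]\<close> in the list.\<close>
      then have "y \<noteq> []" and "\<not> fmatch \<mu> c (P ! length y)"
        using that by (auto simp: I_def decreasing_def isPromoted_def width_def)
      then show ?thesis
        using that(1) unfolding I_def \<sigma> rollback_def decreasing_def by auto
    qed
    show "(rollback \<sigma>, \<sigma>) \<in> measure length" if "I \<sigma>" "?b \<sigma>" for \<sigma>
      using that by (auto simp: rollback_def)
  qed auto
  then have I: "I \<tau>'" and b: "\<not> ?b \<tau>'" by blast+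
  from I show "decreasing \<tau>'" "[] \<in> set \<tau>'" "set \<tau>' \<subseteq> set \<tau>"
    and "\<And>x. \<lbrakk>x \<in> set \<tau>; fmatch \<mu> c (P ! length x)\<rbrakk> \<Longrightarrow> x \<in> set \<tau>'"
    by (auto simp: I_def)
  show "\<tau>' = [[]] \<or> isPromoted P \<mu> \<tau>' c"
    using b \<open>[] \<in> set \<tau>'\<close> by (cases \<tau>' rule: remdups_adj.cases) auto
qed

text \<open>This is the invariant of one visit: a non-empty matching suffix of the extended word is
  a matching suffix of \<open>w\<close>, shorter than \<open>P\<close>, followed by the new
  label.\<close>

lemma visitNode_trajectory_of:
  fixes P :: "('s, 'd::linorder) fuzzy_pattern"
  assumes "P \<noteq> []" and \<tau>: "trajectory_of P \<mu> w \<tau>"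
  obtains \<tau>' where "trajectory_of P \<mu> (w @ [\<xi> g]) \<tau>'"
    and "visitNode \<xi> P \<mu> g \<tau> out =
           (\<tau>', if suffix_occurrence P \<mu> (w @ [\<xi> g]) then out @ [g] else out)"
proof -
  let ?c = "\<xi> g" and ?w = "w @ [\<xi> g]"
  define \<tau>1 where "\<tau>1 = while (\<lambda>\<tau>. length \<tau> > 1 \<and> \<not> isPromoted P \<mu> \<tau> ?c) rollback \<tau>"
  define \<tau>2 where "\<tau>2 = (if isPromoted P \<mu> \<tau>1 ?c then promote P \<mu> \<tau>1 ?c else \<tau>1)"
  have dec: "decreasing \<tau>" and nil: "[] \<in> set \<tau>"
    and set: "set \<tau> = {x. suffix x w \<and> length x < length P \<and> prefix_match P \<mu> x}"
    using assms by (auto simp: trajectory_of_def)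
  note loop = rollback_loop[OF dec nil, where P = P and \<mu> = \<mu> and c = ?c, folded \<tau>1_def]
  have dec2: "decreasing \<tau>2"
    using loop(1) by (simp add: \<tau>2_def promote_decreasing)
  have "set \<tau>2 = {x @ [?c] | x. x \<in> set \<tau> \<and> fmatch \<mu> ?c (P ! length x)} \<union> {[]}"
  proof (cases "isPromoted P \<mu> \<tau>1 ?c")
    case True
    then show ?thesis
      using loop by (auto simp: \<tau>2_def promote_decreasing)
  next
    case False
    then have "\<tau>1 = [[]]"
      using loop(5) by simp
    moreover from this False have "\<not> fmatch \<mu> ?c (P ! 0)"
      by (simp add: isPromoted_def width_def)
    \<comment> \<open>An extendable string would have survived the loop, hence be \<open>[]\<close>,
      which the failed test at position 0 excludes.\<close>
    ultimately have "{x \<in> set \<tau>. fmatch \<mu> ?c (P ! length x)} = {}"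
      using loop(4) by force
    then show ?thesis
      using False \<open>\<tau>1 = [[]]\<close> by (auto simp: \<tau>2_def)
  qed
  also have "\<dots> = {x. suffix x ?w \<and> prefix_match P \<mu> x}" (is "?A = ?B")
  proof (intro set_eqI iffI)
    show "x \<in> ?B" if "x \<in> ?A" for x
      using that unfolding set by (auto simp: suffix_snoc)
    show "x \<in> ?A" if "x \<in> ?B" for x
      using that by (cases x rule: rev_cases) (simp_all add: set)
  qed
  finally have set2: "set \<tau>2 = {x. suffix x ?w \<and> prefix_match P \<mu> x}" .
  then have "[] \<in> set \<tau>2"
    by simp
  then obtain y ys where \<tau>2: "\<tau>2 = y # ys"
    by (cases \<tau>2) simp_all
  have lt: "length x < length y" if "x \<in> set ys" for x
    using dec2 that by (simp add: \<tau>2 decreasing_def)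
  have "y \<in> set \<tau>2"
    by (simp add: \<tau>2)
  then have y: "suffix y ?w" "prefix_match P \<mu> y"
    unfolding set2 by simp_all
  then have le: "length y \<le> length P"
    by (simp add: prefix_match_def)
  \<comment> \<open>The head \<open>y\<close> is the longest matching suffix, so testing its length
    alone decides whether some suffix has full length.\<close>
  have occ: "width \<tau>2 = length P \<longleftrightarrow> suffix_occurrence P \<mu> ?w"
  proof
    assume "suffix_occurrence P \<mu> ?w"
    then obtain x where "x \<in> set \<tau>2" "length x = length P"
      unfolding set2 suffix_occurrence_def by blast
    then show "width \<tau>2 = length P"
      using lt[of x] le by (auto simp: \<tau>2 width_def)
  qed (use y in \<open>auto simp: \<tau>2 width_def suffix_occurrence_def\<close>)
  define \<tau>3 where "\<tau>3 = (if width \<tau>2 = length P then rollback \<tau>2 else \<tau>2)"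
  have "decreasing \<tau>3"
    using dec2 by (simp add: \<tau>3_def rollback_def decreasing_def \<tau>2)
  \<comment> \<open>By strict decrease only the head can have full length, so a single rollback
    suffices.\<close>
  moreover have "set \<tau>3 = {x \<in> set \<tau>2. length x < length P}"
    using le by (auto simp: \<tau>3_def rollback_def \<tau>2 width_def dest: lt)
  ultimately have "trajectory_of P \<mu> ?w \<tau>3"
    using set2 by (auto simp: trajectory_of_def)
  moreover have "visitNode \<xi> P \<mu> g \<tau> out =
      (\<tau>3, if suffix_occurrence P \<mu> ?w then out @ [g] else out)"
    unfolding visitNode_def Let_def \<tau>1_def[symmetric] \<tau>2_def[symmetric]
    by (simp add: \<tau>3_def flip: occ)
  ultimately show thesis
    by (rule that)
qed

section \<open>Descending chains and the nodes to be printed below a node\<close>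

text \<open>\<open>successively\<close> distributes over appended lists, which allows chains to be
  cut and joined without indices.\<close>

lemma descending_chain_successively:
  "descending_chain G succ gs \<longleftrightarrow>
     gs \<noteq> [] \<and> set gs \<subseteq> G \<and> successively (\<lambda>a b. b \<in> set (succ a)) gs"
proof -
  have "(\<forall>i. 1 \<le> i \<and> i < length gs \<longrightarrow> gs ! i \<in> set (succ (gs ! (i - 1)))) \<longleftrightarrow>
        (\<forall>i. Suc i < length gs \<longrightarrow> gs ! Suc i \<in> set (succ (gs ! i)))"
    by (auto simp: Suc_le_eq gr0_conv_Suc)
  then show ?thesis
    by (simp add: descending_chain_def successively_conv_nth)
qed

lemma descending_chain_Cons:
  "descending_chain G succ (g # gs) \<longleftrightarrow>
     g \<in> G \<and> (gs = [] \<or> hd gs \<in> set (succ g) \<and> descending_chain G succ gs)"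
  by (cases gs) (auto simp: descending_chain_successively)

text \<open>These are the nodes to be printed in the subtree of \<open>g\<close> when the labels
  above \<open>g\<close> spell \<open>w\<close>. The suffix is taken of the whole word, so an
  occurrence may begin above \<open>g\<close>.\<close>

definition found_below ::
  "'g set \<Rightarrow> ('g \<Rightarrow> 'g list) \<Rightarrow> ('g \<Rightarrow> 's) \<Rightarrow> ('s, 'd::linorder) fuzzy_pattern \<Rightarrow> 'd
     \<Rightarrow> 'g \<Rightarrow> 's list \<Rightarrow> 'g set" where
  "found_below G succ \<xi> P \<mu> g w =
     {last gs | gs. descending_chain G succ gs \<and> hd gs = g \<and>
        suffix_occurrence P \<mu> (w @ map \<xi> gs)}"

text \<open>A chain from \<open>g\<close> either stops there or continues to a child; in the second
  case the label of \<open>g\<close> moves from the chain into the word.\<close>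

lemma found_below_rec:
  assumes "g \<in> G" "set (succ g) \<subseteq> G"
  shows "found_below G succ \<xi> P \<mu> g w =
    (if suffix_occurrence P \<mu> (w @ [\<xi> g]) then {g} else {}) \<union>
    (\<Union>g' \<in> set (succ g). found_below G succ \<xi> P \<mu> g' (w @ [\<xi> g]))" (is "?L = ?R")
proof (intro set_eqI iffI)
  fix h assume "h \<in> ?L"
  then obtain gs where gs: "descending_chain G succ gs" "hd gs = g"
      "suffix_occurrence P \<mu> (w @ map \<xi> gs)" "h = last gs"
    by (auto simp: found_below_def)
  then obtain gs' where gs': "gs = g # gs'"
    by (cases gs) (auto simp: descending_chain_def)
  show "h \<in> ?R"
  proof (cases "gs' = []")
    case True
    then show ?thesis using gs gs' by simp
  next
    case False
    then have "hd gs' \<in> set (succ g)" "h \<in> found_below G succ \<xi> P \<mu> (hd gs') (w @ [\<xi> g])"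
      using gs gs' by (auto simp: found_below_def descending_chain_Cons)
    then show ?thesis by blast
  qed
next
  fix h assume "h \<in> ?R"
  then consider "suffix_occurrence P \<mu> (w @ [\<xi> g])" "h = g"
    | g' where "g' \<in> set (succ g)" "h \<in> found_below G succ \<xi> P \<mu> g' (w @ [\<xi> g])"
    by (auto split: if_splits)
  then show "h \<in> ?L"
  proof cases
    case 1
    then show ?thesis
      unfolding found_below_def
      by (intro CollectI exI[of _ "[g]"]) (simp add: descending_chain_Cons assms)
  next
    case 2
    then obtain gs where gs: "descending_chain G succ gs" "hd gs = g'"
        "suffix_occurrence P \<mu> (w @ map \<xi> (g # gs))" "h = last gs"
      by (auto simp: found_below_def)
    then have "gs \<noteq> []"
      by (simp add: descending_chain_def)
    then show ?thesis
      unfolding found_below_def using gs 2 assms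
      by (intro CollectI exI[of _ "g # gs"]) (simp add: descending_chain_Cons)
  qed
qed

section \<open>Well-foundedness of the tree\<close>

text \<open>A cycle through a node enters it from its only parent, so the parent lies on a cycle
  too. Moving up in this way reaches the root, which no edge enters.\<close>

lemma acyclic_if_unique_parents:
  assumes root: "\<And>p. (p, r) \<notin> E"
    and parent: "\<And>g p q. \<lbrakk>(p, g) \<in> E; (q, g) \<in> E\<rbrakk> \<Longrightarrow> p = q"
    and reach: "\<And>p g. (p, g) \<in> E \<Longrightarrow> (r, g) \<in> E\<^sup>*"
  shows "acyclic E"
proof -
  have no_cycle: "(g, g) \<notin> E\<^sup>+" if "(r, g) \<in> E\<^sup>*" for g
    using that
  proof (induction rule: rtrancl_induct)
    case base
    show ?case
      using root by (auto dest: tranclD2)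
  next
    case (step p g)
    show ?case
    proof
      assume "(g, g) \<in> E\<^sup>+"
      then obtain q where "(g, q) \<in> E\<^sup>*" "(q, g) \<in> E"
        by (auto dest: tranclD2)
      then have "(p, p) \<in> E\<^sup>+"
        using parent[OF step(2)] step(2) by (auto intro: rtrancl_into_trancl2)
      then show False
        using step.IH by simp
    qed
  qed
  show ?thesis
  proof (rule acyclicI, intro allI notI)
    fix g assume cycle: "(g, g) \<in> E\<^sup>+"
    then obtain p where "(p, g) \<in> E"
      by (auto dest: tranclD2)
    then show False
      using cycle no_cycle reach by blast
  qed
qed

text \<open>The converse makes children smaller than their parent, so induction may assume a claim
  for all child subtrees.\<close>

lemma finite_ordered_tree_wf:
  assumes "finite_ordered_tree G \<Lambda> succ"
  shows "wf ({(a, b). a \<in> G \<and> b \<in> set (succ a)}\<inverse>)"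
proof (rule finite_acyclic_wf_converse)
  let ?E = "{(a, b). a \<in> G \<and> b \<in> set (succ a)}"
  have sub: "\<And>a b. \<lbrakk>a \<in> G; b \<in> set (succ a)\<rbrakk> \<Longrightarrow> b \<in> G" and fin: "finite G"
    and root: "\<And>p. p \<in> G \<Longrightarrow> \<Lambda> \<notin> set (succ p)"
    and parent: "\<And>g. \<lbrakk>g \<in> G; g \<noteq> \<Lambda>\<rbrakk> \<Longrightarrow> \<exists>!p. p \<in> G \<and> g \<in> set (succ p)"
    and reach: "\<And>g. g \<in> G \<Longrightarrow> (\<Lambda>, g) \<in> ?E\<^sup>*"
    using assms unfolding finite_ordered_tree_def by blast+
  have "?E \<subseteq> G \<times> G"
    using sub by auto
  then show "finite ?E"
    using fin by (auto intro: finite_subset)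
  show "acyclic ?E"
  proof (rule acyclic_if_unique_parents)
    show "(p, \<Lambda>) \<notin> ?E" for p
      using root by simp
    show "p = q" if "(p, g) \<in> ?E" "(q, g) \<in> ?E" for g p q
    proof -
      have "g \<in> G" "g \<noteq> \<Lambda>"
        using that sub root by auto
      then show ?thesis
        using parent that by blast
    qed
    show "(\<Lambda>, g) \<in> ?E\<^sup>*" if "(p, g) \<in> ?E" for p g
      using that sub[of p g] by (intro reach) simp
  qed
qed

section \<open>The run of the algorithm on a subtree\<close>

abbreviation fh_run ::
  "('g \<Rightarrow> 'g list) \<Rightarrow> ('g \<Rightarrow> 's) \<Rightarrow> ('s, 'd::linorder) fuzzy_pattern \<Rightarrow> 'd
     \<Rightarrow> ('g \<times> 's trajectory) list \<times> 'g list
     \<Rightarrow> (('g \<times> 's trajectory) list \<times> 'g list) option" where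
  "fh_run succ \<xi> P \<mu> \<equiv> while_option (\<lambda>(stack, out). stack \<noteq> []) (fh_step succ \<xi> P \<mu>)"

text \<open>The work on a subtree is a finite initial piece of the run that uncovers the rest of the
  stack. Equating two runs, with \<open>stack\<close> and \<open>out\<close> arbitrary, lets such
  pieces be chained and defers termination to the empty stack.\<close>

lemma fh_run_subtree:
  fixes P :: "('s, 'd::linorder) fuzzy_pattern"
  assumes tree: "finite_ordered_tree G \<Lambda> succ" and P: "P \<noteq> []"
    and "g \<in> G" "trajectory_of P \<mu> w \<tau>"
  shows "\<exists>out'. fh_run succ \<xi> P \<mu> ((g, \<tau>) # stack, out) = fh_run succ \<xi> P \<mu> (stack, out') \<and>
           set out' = set out \<union> found_below G succ \<xi> P \<mu> g w"
  using finite_ordered_tree_wf[OF tree] assms(3,4)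
proof (induction g arbitrary: w \<tau> stack out rule: wf_induct_rule)
  case (less g)
  let ?w = "w @ [\<xi> g]"
  have sub: "set (succ g) \<subseteq> G"
    using tree \<open>g \<in> G\<close> by (auto simp: finite_ordered_tree_def)
  obtain \<tau>' where \<tau>': "trajectory_of P \<mu> ?w \<tau>'"
    and visit: "visitNode \<xi> P \<mu> g \<tau> out =
      (\<tau>', if suffix_occurrence P \<mu> ?w then out @ [g] else out)" (is "_ = (_, ?out)")
    using visitNode_trajectory_of[OF P less.prems(2)] .
  \<comment> \<open>All children carry the same \<tau>'. The first one is on top, and its subtree is
    finished before the next child is popped.\<close>
  have children: "\<exists>out''. fh_run succ \<xi> P \<mu> (foldr (\<lambda>g' st. (g', \<tau>') # st) gs stack, out') =
        fh_run succ \<xi> P \<mu> (stack, out'') \<and>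
      set out'' = set out' \<union> (\<Union>g'\<in>set gs. found_below G succ \<xi> P \<mu> g' ?w)"
    if "set gs \<subseteq> set (succ g)" for gs out'
    using that
  proof (induction gs arbitrary: out')
    case Nil
    show ?case by (intro exI[of _ out']) simp
  next
    case (Cons g' gs)
    let ?stack = "foldr (\<lambda>g' st. (g', \<tau>') # st) gs stack"
    have "(g', g) \<in> {(a, b). a \<in> G \<and> b \<in> set (succ a)}\<inverse>" "g' \<in> G"
      using Cons.prems sub \<open>g \<in> G\<close> by auto
    from less.IH[OF this \<tau>', of ?stack out'] obtain out1 where
      1: "fh_run succ \<xi> P \<mu> ((g', \<tau>') # ?stack, out') = fh_run succ \<xi> P \<mu> (?stack, out1)"
        "set out1 = set out' \<union> found_below G succ \<xi> P \<mu> g' ?w"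
      by blast
    have "set gs \<subseteq> set (succ g)"
      using Cons.prems by simp
    from Cons.IH[OF this, of out1] obtain out2 where
      2: "fh_run succ \<xi> P \<mu> (?stack, out1) = fh_run succ \<xi> P \<mu> (stack, out2)"
        "set out2 = set out1 \<union> (\<Union>g'\<in>set gs. found_below G succ \<xi> P \<mu> g' ?w)"
      by blast
    show ?case
      by (intro exI[of _ out2]) (simp add: 1 2 Un_assoc)
  qed
  \<comment> \<open>One unfolding of the loop visits \<open>g\<close> and replaces it by its
    children.\<close>
  have "fh_run succ \<xi> P \<mu> ((g, \<tau>) # stack, out) =
      fh_run succ \<xi> P \<mu> (foldr (\<lambda>g' st. (g', \<tau>') # st) (succ g) stack, ?out)"
    by (subst while_option_unfold) (simp add: fh_step_def visit)
  moreover obtain out'' where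
    "fh_run succ \<xi> P \<mu> (foldr (\<lambda>g' st. (g', \<tau>') # st) (succ g) stack, ?out) =
       fh_run succ \<xi> P \<mu> (stack, out'')"
    "set out'' = set ?out \<union> (\<Union>g'\<in>set (succ g). found_below G succ \<xi> P \<mu> g' ?w)"
    using children[OF subset_refl] by blast
  ultimately show ?case
    by (intro exI[of _ out'']) (simp add: found_below_rec[of g G succ \<xi> P \<mu> w] \<open>g \<in> G\<close> sub Un_assoc)
qed

section \<open>From paths starting at the root to occurrences\<close>

lemma ex_descending_chain_from_root:
  assumes "finite_ordered_tree G \<Lambda> succ" "g \<in> G"
  shows "\<exists>gs. descending_chain G succ gs \<and> hd gs = \<Lambda> \<and> last gs = g"
proof -
  have "(\<Lambda>, g) \<in> {(a, b). a \<in> G \<and> b \<in> set (succ a)}\<^sup>*" "\<Lambda> \<in> G"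
    and sub: "\<And>g. g \<in> G \<Longrightarrow> set (succ g) \<subseteq> G"
    using assms by (auto simp: finite_ordered_tree_def)
  from this(1) show ?thesis
  proof (induction rule: rtrancl_induct)
    case base
    then show ?case
      using \<open>\<Lambda> \<in> G\<close> by (intro exI[of _ "[\<Lambda>]"]) (simp add: descending_chain_Cons)
  next
    case (step p g)
    then obtain gs where "descending_chain G succ gs" "hd gs = \<Lambda>" "last gs = p"
      by blast
    then show ?case
      using step(2) sub[of p]
      by (intro exI[of _ "gs @ [g]"])
        (auto simp: descending_chain_successively successively_append_iff)
  qed
qed

lemma mu_occurrence_iff:
  "mu_occurrence G succ \<xi> P \<mu> gs \<longleftrightarrow>
     descending_chain G succ gs \<and> length gs = length P \<and> prefix_match P \<mu> (map \<xi> gs)"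
  by (auto simp: mu_occurrence_def prefix_match_def)

text \<open>One inclusion cuts the matching end off a chain from the root; the other prolongs an
  occurrence upwards to the root.\<close>

lemma found_below_root:
  assumes tree: "finite_ordered_tree G \<Lambda> succ" and "P \<noteq> []"
  shows "found_below G succ \<xi> P \<mu> \<Lambda> [] = {last gs | gs. mu_occurrence G succ \<xi> P \<mu> gs}"
proof (intro set_eqI iffI)
  fix g assume "g \<in> found_below G succ \<xi> P \<mu> \<Lambda> []"
  then obtain gs x where gs: "descending_chain G succ gs" "g = last gs"
    and x: "suffix x (map \<xi> gs)" "length x = length P" "prefix_match P \<mu> x"
    by (auto simp: found_below_def suffix_occurrence_def)
  from x(1) obtain us vs where "gs = us @ vs" "x = map \<xi> vs"
    by (auto simp: suffix_def map_eq_append_conv)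
  \<comment> \<open>Non-emptiness ensures that \<open>vs\<close> and \<open>gs\<close> end in the
    same node.\<close>
  moreover from this have "vs \<noteq> []"
    using x(2) \<open>P \<noteq> []\<close> by auto
  ultimately have "mu_occurrence G succ \<xi> P \<mu> vs" "g = last vs"
    using gs x
    by (simp_all add: mu_occurrence_iff descending_chain_successively successively_append_iff)
  then show "g \<in> {last gs | gs. mu_occurrence G succ \<xi> P \<mu> gs}"
    by blast
next
  fix g assume "g \<in> {last gs | gs. mu_occurrence G succ \<xi> P \<mu> gs}"
  then obtain gs where gs: "mu_occurrence G succ \<xi> P \<mu> gs" "g = last gs"
    by blast
  then obtain v vs where "gs = v # vs"
    by (cases gs) (simp_all add: mu_occurrence_iff descending_chain_def)
  note vs = gs[unfolded this]
  then have "v \<in> G"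
    by (simp add: mu_occurrence_iff descending_chain_def)
  then obtain us where "descending_chain G succ us" "hd us = \<Lambda>" "last us = v"
    using ex_descending_chain_from_root[OF tree] by blast
  \<comment> \<open>The root chain ends in \<open>v\<close>, where the occurrence begins;
    \<open>v\<close> is split off so that it appears only once in the joined chain.\<close>
  moreover from this obtain us' where us': "us = us' @ [v]"
    by (cases us rule: rev_cases) (simp_all add: descending_chain_def)
  ultimately have "descending_chain G succ (us' @ v # vs)" "hd (us' @ v # vs) = \<Lambda>"
    using vs(1)
    by (simp_all add: us' mu_occurrence_iff descending_chain_successively
        successively_append_iff hd_append split: if_splits)
  moreover have "suffix_occurrence P \<mu> (map \<xi> (us' @ v # vs))"
    unfolding suffix_occurrence_def using vs(1)
    by (intro exI[of _ "map \<xi> (v # vs)"])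
      (simp add: mu_occurrence_iff suffix_appendI del: list.map(2))
  ultimately show "g \<in> found_below G succ \<xi> P \<mu> \<Lambda> []"
    unfolding found_below_def using vs(2)
    by (intro CollectI exI[of _ "us' @ v # vs"]) simp
qed

theorem theorem4p2:
  fixes G :: "'g set" and \<Lambda> :: 'g and succ :: "'g \<Rightarrow> 'g list"
    and \<xi> :: "'g \<Rightarrow> 's::finite"
    and P :: "('s, 'd::{linorder, order_bot, order_top}) fuzzy_pattern" and \<mu> :: 'd
  assumes "finite_ordered_tree G \<Lambda> succ" and "P \<noteq> []"
  shows "\<exists>out. fh_matching \<Lambda> succ \<xi> P \<mu> = Some out \<and> set out \<subseteq> G \<and>
           (\<forall>g\<in>G. g \<in> set out \<longleftrightarrow> (\<exists>gs. mu_occurrence G succ \<xi> P \<mu> gs \<and> last gs = g))"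
proof -
  have "\<Lambda> \<in> G"
    using assms(1) by (simp add: finite_ordered_tree_def)
  \<comment> \<open>Nothing lies above the root, so the word is empty; its only suffix
    \<open>[]\<close> is shorter than the non-empty \<open>P\<close>.\<close>
  moreover have "trajectory_of P \<mu> [] [[]]"
    using assms(2) by (auto simp: trajectory_of_def decreasing_def)
  ultimately obtain out where
    run: "fh_run succ \<xi> P \<mu> ([(\<Lambda>, [[]])], []) = fh_run succ \<xi> P \<mu> ([], out)"
    and "set out = set [] \<union> found_below G succ \<xi> P \<mu> \<Lambda> []"
    using fh_run_subtree[OF assms] by blast
  then have out: "set out = {last gs | gs. mu_occurrence G succ \<xi> P \<mu> gs}"
    using found_below_root[OF assms] by simp
  \<comment> \<open>The loop stops at the empty stack, so the equation \<open>run\<close> also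
    yields termination of the whole algorithm.\<close>
  have "fh_run succ \<xi> P \<mu> ([], out) = Some ([], out)"
    by (subst while_option_unfold) simp
  then have "fh_matching \<Lambda> succ \<xi> P \<mu> = Some out"
    by (simp add: fh_matching_def run)
  moreover have "set out \<subseteq> G"
    unfolding out by (auto simp: mu_occurrence_def descending_chain_def)
  ultimately show ?thesis
    using out by auto
qed

end
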